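(* The model-checking problem for QCTL*_i under tree semantics is undecidable.
   Context: QCTL*_i extends CTL* with second-order quantifiers ∃^o p.φ over atomic propositions, annotated with a concrete observation o ⊆ [n]. Models are compound Kripke structures (CKS), whose states are tuples of local states in ∏_{i∈[n]} L_i (the L_i disjoint finite sets). Under tree semantics formulas are evaluated on the tree unfolding of the CKS from its initial state; ∃^o p.φ holds in a labelled tree t if there is a tree t' equal to t except possibly for the labelling of p, such that t' is o-uniform in p (any two nodes of the same depth whose states agree pointwise on the components indexed by o agree on p) and t' satisfies φ. The model-checking problem: given a CKS K and a QCTL*_i formula φ, decide whether the unfolding of K satisfies φ. *)

theory Defs
  imports Main "HOL-Library.Nat_Bijection"
begin

datatype recf = RZero | RSucc | RProj nat | RComp recf "recf list" | RPr recf recf | RMn recf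

inductive evalr :: "recf \<Rightarrow> nat list \<Rightarrow> nat \<Rightarrow> bool" where
  ev_zero: "evalr RZero xs 0"
| ev_succ: "evalr RSucc (x # xs) (Suc x)"
| ev_proj: "i < length xs \<Longrightarrow> evalr (RProj i) xs (xs ! i)"
| ev_comp: "length ys = length gs \<Longrightarrow> (\<forall>i < length gs. evalr (gs ! i) xs (ys ! i))
            \<Longrightarrow> evalr f ys z \<Longrightarrow> evalr (RComp f gs) xs z"
| ev_pr0: "evalr f xs z \<Longrightarrow> evalr (RPr f g) (0 # xs) z"
| ev_prS: "evalr (RPr f g) (n # xs) y \<Longrightarrow> evalr g (n # y # xs) z
            \<Longrightarrow> evalr (RPr f g) (Suc n # xs) z"
| ev_mn: "evalr f (n # xs) 0 \<Longrightarrow> (\<forall>m < n. \<exists>y. evalr f (m # xs) (Suc y))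
            \<Longrightarrow> evalr (RMn f) xs n"

definition decidable_set :: "nat set \<Rightarrow> bool" where
  "decidable_set A \<longleftrightarrow> (\<exists>f. \<forall>x. evalr f [x] (if x \<in> A then 1 else 0))"

text \<open>Local states and atomic propositions are naturals; a state is a tuple of local
  states, represented as a list of length n (components indexed 0..n-1).\<close>

record cks =
  ncomp :: nat
  locs  :: "nat list list"                       \<comment> \<open>locs ! i lists the local states L_i\<close>
  sts   :: "nat list list"
  trans :: "(nat list \<times> nat list) list"
  lab   :: "(nat list \<times> nat) list"               \<comment> \<open>(s,p): proposition p holds in s\<close>
  init  :: "nat list"

definition wf_cks :: "cks \<Rightarrow> bool" where
  "wf_cks K \<longleftrightarrow>
     length (locs K) = ncomp K \<and>
     (\<forall>i < ncomp K. \<forall>j < ncomp K. i \<noteq> j \<longrightarrow> set (locs K ! i) \<inter> set (locs K ! j) = {}) \<and>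
     (\<forall>s \<in> set (sts K). length s = ncomp K \<and> (\<forall>i < ncomp K. s ! i \<in> set (locs K ! i))) \<and>
     init K \<in> set (sts K) \<and>
     (\<forall>(s, t) \<in> set (trans K). s \<in> set (sts K) \<and> t \<in> set (sts K)) \<and>
     (\<forall>s \<in> set (sts K). \<exists>t. (s, t) \<in> set (trans K)) \<and>
     (\<forall>(s, p) \<in> set (lab K). s \<in> set (sts K))"

definition tnode :: "cks \<Rightarrow> nat list list \<Rightarrow> bool" where
  "tnode K u \<longleftrightarrow> u \<noteq> [] \<and> hd u = init K \<and>
     (\<forall>i. Suc i < length u \<longrightarrow> (u ! i, u ! Suc i) \<in> set (trans K))"

definition tpath :: "cks \<Rightarrow> (nat \<Rightarrow> nat list list) \<Rightarrow> bool" where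
  "tpath K \<pi> \<longleftrightarrow> (\<forall>i. tnode K (\<pi> i) \<and>
     (\<exists>s. \<pi> (Suc i) = \<pi> i @ [s] \<and> (last (\<pi> i), s) \<in> set (trans K)))"

definition lab0 :: "cks \<Rightarrow> nat list list \<Rightarrow> nat set" where
  "lab0 K u = {p. (last u, p) \<in> set (lab K)}"

definition obs_eq :: "nat list \<Rightarrow> nat list list \<Rightarrow> nat list list \<Rightarrow> bool" where
  "obs_eq ob u v \<longleftrightarrow> length u = length v \<and>
     (\<forall>k < length u. \<forall>i \<in> set ob. u ! k ! i = v ! k ! i)"

definition uniform :: "cks \<Rightarrow> nat list \<Rightarrow> nat \<Rightarrow> (nat list list \<Rightarrow> nat set) \<Rightarrow> bool" where
  "uniform K ob p lb \<longleftrightarrow>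
     (\<forall>u v. tnode K u \<and> tnode K v \<and> obs_eq ob u v \<longrightarrow> (p \<in> lb u \<longleftrightarrow> p \<in> lb v))"

datatype sform =
    SProp nat
  | SNeg sform
  | SAnd sform sform
  | SE pform
  | SEx "nat list" nat sform
and pform =
    PS sform
  | PNeg pform
  | PAnd pform pform
  | PX pform
  | PU pform pform

primrec ssat :: "cks \<Rightarrow> (nat list list \<Rightarrow> nat set) \<Rightarrow> nat list list \<Rightarrow> sform \<Rightarrow> bool"
  and psat :: "cks \<Rightarrow> (nat list list \<Rightarrow> nat set) \<Rightarrow> (nat \<Rightarrow> nat list list) \<Rightarrow> pform \<Rightarrow> bool"
where
  "ssat K lb u (SProp p) = (p \<in> lb u)"
| "ssat K lb u (SNeg \<phi>) = (\<not> ssat K lb u \<phi>)"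
| "ssat K lb u (SAnd \<phi> \<psi>) = (ssat K lb u \<phi> \<and> ssat K lb u \<psi>)"
| "ssat K lb u (SE \<psi>) = (\<exists>\<pi>. tpath K \<pi> \<and> \<pi> 0 = u \<and> psat K lb \<pi> \<psi>)"
| "ssat K lb u (SEx ob p \<phi>) =
     (\<exists>lab'. (\<forall>v q. q \<noteq> p \<longrightarrow> (q \<in> lab' v \<longleftrightarrow> q \<in> lb v)) \<and> uniform K ob p lab' \<and> ssat K lab' u \<phi>)"
| "psat K lb \<pi> (PS \<phi>) = ssat K lb (\<pi> 0) \<phi>"
| "psat K lb \<pi> (PNeg \<psi>) = (\<not> psat K lb \<pi> \<psi>)"
| "psat K lb \<pi> (PAnd \<psi> \<chi>) = (psat K lb \<pi> \<psi> \<and> psat K lb \<pi> \<chi>)"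
| "psat K lb \<pi> (PX \<psi>) = psat K lb (\<lambda>i. \<pi> (Suc i)) \<psi>"
| "psat K lb \<pi> (PU \<psi> \<chi>) =
     (\<exists>j. psat K lb (\<lambda>i. \<pi> (i + j)) \<chi> \<and> (\<forall>k < j. psat K lb (\<lambda>i. \<pi> (i + k)) \<psi>))"

primrec wf_sform :: "nat \<Rightarrow> sform \<Rightarrow> bool" and wf_pform :: "nat \<Rightarrow> pform \<Rightarrow> bool" where
  "wf_sform n (SProp p) = True"
| "wf_sform n (SNeg \<phi>) = wf_sform n \<phi>"
| "wf_sform n (SAnd \<phi> \<psi>) = (wf_sform n \<phi> \<and> wf_sform n \<psi>)"
| "wf_sform n (SE \<psi>) = wf_pform n \<psi>"
| "wf_sform n (SEx ob p \<phi>) = ((\<forall>i \<in> set ob. i < n) \<and> wf_sform n \<phi>)"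
| "wf_pform n (PS \<phi>) = wf_sform n \<phi>"
| "wf_pform n (PNeg \<psi>) = wf_pform n \<psi>"
| "wf_pform n (PAnd \<psi> \<chi>) = (wf_pform n \<psi> \<and> wf_pform n \<chi>)"
| "wf_pform n (PX \<psi>) = wf_pform n \<psi>"
| "wf_pform n (PU \<psi> \<chi>) = (wf_pform n \<psi> \<and> wf_pform n \<chi>)"

definition mc :: "cks \<Rightarrow> sform \<Rightarrow> bool" where
  "mc K \<phi> \<longleftrightarrow> wf_cks K \<and> wf_sform (ncomp K) \<phi> \<and> ssat K (lab0 K) [init K] \<phi>"

definition enc_nll :: "nat list list \<Rightarrow> nat" where
  "enc_nll xss = list_encode (map list_encode xss)"

primrec enc_s :: "sform \<Rightarrow> nat" and enc_p :: "pform \<Rightarrow> nat" where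
  "enc_s (SProp p) = list_encode [0, p]"
| "enc_s (SNeg \<phi>) = list_encode [1, enc_s \<phi>]"
| "enc_s (SAnd \<phi> \<psi>) = list_encode [2, enc_s \<phi>, enc_s \<psi>]"
| "enc_s (SE \<psi>) = list_encode [3, enc_p \<psi>]"
| "enc_s (SEx ob p \<phi>) = list_encode [4, list_encode ob, p, enc_s \<phi>]"
| "enc_p (PS \<phi>) = list_encode [5, enc_s \<phi>]"
| "enc_p (PNeg \<psi>) = list_encode [6, enc_p \<psi>]"
| "enc_p (PAnd \<psi> \<chi>) = list_encode [7, enc_p \<psi>, enc_p \<chi>]"
| "enc_p (PX \<psi>) = list_encode [8, enc_p \<psi>]"
| "enc_p (PU \<psi> \<chi>) = list_encode [9, enc_p \<psi>, enc_p \<chi>]"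

definition enc_cks :: "cks \<Rightarrow> nat" where
  "enc_cks K = list_encode
     [ ncomp K, enc_nll (locs K), enc_nll (sts K),
       list_encode (map (\<lambda>(s, t). prod_encode (list_encode s, list_encode t)) (trans K)),
       list_encode (map (\<lambda>(s, p). prod_encode (list_encode s, p)) (lab K)),
       list_encode (init K) ]"

definition MC_set :: "nat set" where
  "MC_set = {prod_encode (enc_cks K, enc_s \<phi>) | K \<phi>. mc K \<phi>}"

end

theory Submission
  imports Defs
begin

text \<open>Tarski-style diagonalisation. Over a fixed four-state structure, second-order arithmetic without
  addition is interpreted in QCTL*: a blindly quantified proposition true at one level is a
  number, a path with two marked levels is a pair, and a fully observed proposition on such
  paths is a binary relation. Every recursive function is therefore definable, and the
  computable map that substitutes the code of a formula for its own free variable yields a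
  sentence that holds iff the supposed decision procedure rejects it.\<close>

section \<open>Recursive functions\<close>

inductive_cases evalr_zeroE: "evalr RZero xs z"
inductive_cases evalr_succE: "evalr RSucc xs z"
inductive_cases evalr_projE: "evalr (RProj i) xs z"
inductive_cases evalr_compE: "evalr (RComp f gs) xs z"
inductive_cases evalr_prE: "evalr (RPr f g) xs z"
inductive_cases evalr_mnE: "evalr (RMn f) xs z"

text \<open>For \<open>RMn\<close>, the smaller of two distinct minima would give the value zero
  where the other demands a successor. Determinism later keeps a decision procedure from giving both
  answers.\<close>

lemma evalr_det: "evalr f xs y \<Longrightarrow> evalr f xs z \<Longrightarrow> y = z"
proof (induction arbitrary: z rule: evalr.induct)
  case (ev_comp ys gs xs f y)
  from ev_comp.prems obtain zs where zs: "length zs = length gs"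
    "\<forall>i<length gs. evalr (gs ! i) xs (zs ! i)" "evalr f zs z"
    by (rule evalr_compE) auto
  have "ys = zs"
    using ev_comp.hyps(1) ev_comp.IH(1) zs(1,2) by (intro nth_equalityI) auto
  with zs(3) ev_comp.IH show ?case by blast
next
  case (ev_prS f g n xs y w)
  from ev_prS.prems obtain y' where "evalr (RPr f g) (n # xs) y'" "evalr g (n # y' # xs) z"
    by (rule evalr_prE) simp_all
  with ev_prS.IH show ?case by blast
next
  case (ev_mn f n xs)
  from ev_mn.prems have *: "evalr f (z # xs) 0" "\<forall>m<z. \<exists>y. evalr f (m # xs) (Suc y)"
    by (auto elim: evalr_mnE)
  have "\<not> n < z" using *(2) ev_mn.IH(1) by fastforce
  moreover have "\<not> z < n" using *(1) ev_mn.IH(2) by fastforce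
  ultimately show ?case by simp
next
  case (ev_pr0 f xs y g)
  from ev_pr0.prems have "evalr f xs z" by (rule evalr_prE) auto
  with ev_pr0.IH show ?case by blast
qed (auto elim: evalr_zeroE evalr_succE evalr_projE)

lemma evalr_comp_iff:
  "evalr (RComp f gs) xs z \<longleftrightarrow>
   (\<exists>ys. length ys = length gs \<and> (\<forall>i<length gs. evalr (gs ! i) xs (ys ! i)) \<and> evalr f ys z)"
  by (auto elim: evalr_compE intro: ev_comp)

lemma evalr_mn_iff:
  "evalr (RMn f) xs n \<longleftrightarrow> evalr f (n # xs) 0 \<and> (\<forall>m<n. \<exists>y. evalr f (m # xs) (Suc y))"
  by (auto elim: evalr_mnE intro: ev_mn)

text \<open>The least fixed point form of primitive recursion needs a quantifier over binary relations,
  but no coding of finite sequences.\<close>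

lemma evalr_pr_iff:
  "evalr (RPr f g) (n # xs) z \<longleftrightarrow>
   (\<forall>R. (\<forall>v. evalr f xs v \<longrightarrow> R 0 v) \<and>
        (\<forall>m v w. R m v \<and> evalr g (m # v # xs) w \<longrightarrow> R (Suc m) w) \<longrightarrow> R n z)"
    (is "?l \<longleftrightarrow> (\<forall>R. ?C R \<longrightarrow> R n z)")
proof
  assume ?l
  show "\<forall>R. ?C R \<longrightarrow> R n z"
  proof (intro allI impI)
    fix R assume C: "?C R"
    from \<open>?l\<close> show "R n z"
    proof (induction n arbitrary: z)
      case 0
      then show ?case using C by (auto elim: evalr_prE)
    next
      case (Suc n)
      from Suc.prems obtain y where "evalr (RPr f g) (n # xs) y" "evalr g (n # y # xs) z"
        by (rule evalr_prE) auto
      with Suc.IH C show ?case by blast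
    qed
  qed
next
  assume "\<forall>R. ?C R \<longrightarrow> R n z"
  \<comment> \<open>The graph of the recursion is itself closed under \<open>?C\<close>, so it may
    be taken for \<open>R\<close>.\<close>
  then have "?C (\<lambda>n. evalr (RPr f g) (n # xs)) \<longrightarrow> evalr (RPr f g) (n # xs) z"
    by (rule spec)
  then show ?l by (blast intro: ev_pr0 ev_prS)
qed

lemma evalr_comp1: "evalr g xs y \<Longrightarrow> evalr f [y] z \<Longrightarrow> evalr (RComp f [g]) xs z"
  by (rule ev_comp[of "[y]"]) auto

lemma evalr_comp2:
  "evalr g xs y \<Longrightarrow> evalr h xs y' \<Longrightarrow> evalr f [y, y'] z \<Longrightarrow> evalr (RComp f [g, h]) xs z"
  by (rule ev_comp[of "[y, y']"]) (auto simp: less_Suc_eq nth_Cons')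

lemma evalr_projI: "i < length xs \<Longrightarrow> xs ! i = y \<Longrightarrow> evalr (RProj i) xs y"
  using ev_proj by blast

section \<open>Recursive pairing and coding of lists\<close>

primrec rconst :: "nat \<Rightarrow> recf" where
  "rconst 0 = RZero"
| "rconst (Suc n) = RComp RSucc [rconst n]"

lemma evalr_rconst: "evalr (rconst n) xs n"
  by (induction n) (auto intro: ev_zero ev_succ evalr_comp1)

definition radd :: recf where
  "radd = RPr (RProj 0) (RComp RSucc [RProj 1])"

lemma evalr_radd: "evalr radd [m, n] (m + n)"
  unfolding radd_def
  by (induction m)
     (auto intro!: ev_prS ev_pr0[OF evalr_projI] evalr_comp1[OF evalr_projI ev_succ])

definition rtri :: recf where
  "rtri = RPr RZero (RComp radd [RProj 1, RComp RSucc [RProj 0]])"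

lemma evalr_rtri: "evalr rtri [n] (triangle n)"
proof (induction n)
  case 0
  show ?case unfolding rtri_def by (auto intro: ev_pr0 ev_zero)
next
  case (Suc n)
  show ?case unfolding rtri_def
  proof (rule ev_prS)
    show "evalr (RPr RZero (RComp radd [RProj 1, RComp RSucc [RProj 0]])) [n] (triangle n)"
      using Suc by (simp add: rtri_def)
    have "evalr (RComp radd [RProj 1, RComp RSucc [RProj 0]]) [n, triangle n] (triangle n + Suc n)"
      by (rule evalr_comp2[OF evalr_projI evalr_comp1[OF evalr_projI ev_succ] evalr_radd]) auto
    then show "evalr (RComp radd [RProj 1, RComp RSucc [RProj 0]]) [n, triangle n]
        (triangle (Suc n))"
      by simp
  qed
qed

definition rpair :: recf where
  "rpair = RComp radd [RComp rtri [radd], RProj 0]"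

lemma evalr_rpair: "evalr rpair [m, n] (prod_encode (m, n))"
  unfolding rpair_def prod_encode_def
  by (auto intro: evalr_comp2[OF evalr_comp1[OF evalr_radd evalr_rtri] evalr_projI evalr_radd])

primrec rlist :: "recf list \<Rightarrow> recf" where
  "rlist [] = RZero"
| "rlist (g # gs) = RComp RSucc [RComp rpair [g, rlist gs]]"

lemma evalr_rlist:
  "list_all2 (\<lambda>g y. evalr g xs y) gs ys \<Longrightarrow> evalr (rlist gs) xs (list_encode ys)"
  by (induction rule: list_all2_induct)
     (auto intro: ev_zero evalr_comp1[OF evalr_comp2[OF _ _ evalr_rpair] ev_succ])

section \<open>Defining recursive functions in second-order logic\<close>

datatype so =
    Num nat nat
  | Zero nat
  | Succ nat nat
  | Eq nat nat
  | Less nat nat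
  | Rel nat nat
  | Neg so
  | And so so
  | ExN nat so
  | ExR so

text \<open>A single relation variable suffices. The literal \<open>Num v n\<close> is only meaningful for \<open>n > 0\<close>.\<close>

primrec sem :: "(nat \<Rightarrow> nat) \<Rightarrow> (nat \<Rightarrow> nat \<Rightarrow> bool) \<Rightarrow> so \<Rightarrow> bool" where
  "sem E S (Num v n) = (0 < n \<and> E v = n)"
| "sem E S (Zero v) = (E v = 0)"
| "sem E S (Succ v w) = (E w = Suc (E v))"
| "sem E S (Eq v w) = (E v = E w)"
| "sem E S (Less v w) = (E v < E w)"
| "sem E S (Rel v w) = S (E v) (E w)"
| "sem E S (Neg \<phi>) = (\<not> sem E S \<phi>)"
| "sem E S (And \<phi> \<psi>) = (sem E S \<phi> \<and> sem E S \<psi>)"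
| "sem E S (ExN v \<phi>) = (\<exists>n. sem (E(v := n)) S \<phi>)"
| "sem E S (ExR \<phi>) = (\<exists>S'. sem E S' \<phi>)"

abbreviation Imp :: "so \<Rightarrow> so \<Rightarrow> so" where
  "Imp \<phi> \<psi> \<equiv> Neg (And \<phi> (Neg \<psi>))"

abbreviation AllN :: "nat \<Rightarrow> so \<Rightarrow> so" where
  "AllN v \<phi> \<equiv> Neg (ExN v (Neg \<phi>))"

text \<open>\<open>graph f k xs z\<close> says that \<open>f\<close> maps the values of the variables \<open>xs\<close> to the value of the
  variable \<open>z\<close>; the variables from \<open>k\<close> on are available for quantification.\<close>

primrec graph :: "recf \<Rightarrow> nat \<Rightarrow> nat list \<Rightarrow> nat \<Rightarrow> so" where
  "graph RZero = (\<lambda>k xs z. Zero z)"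
| "graph RSucc = (\<lambda>k xs z. if xs = [] then Neg (Eq z z) else Succ (hd xs) z)"
| "graph (RProj i) = (\<lambda>k xs z. if i < length xs then Eq (xs ! i) z else Neg (Eq z z))"
| "graph (RComp f gs) = (\<lambda>k xs z. let ys = [k..<k + length gs]; l = k + length gs in
     foldr ExN ys (foldr And (map2 (\<lambda>G y. G l xs y) (map graph gs) ys) (graph f l ys z)))"
| "graph (RPr f g) = (\<lambda>k xs z. if xs = [] then Neg (Eq z z) else
     Neg (ExR (And
       (AllN k (AllN (k + 1) (AllN (k + 2) (AllN (k + 3) (And
          (Imp (And (Zero k) (graph f (k + 4) (tl xs) (k + 2))) (Rel k (k + 2)))
          (Imp (And (Rel k (k + 2))
                 (And (Succ k (k + 1)) (graph g (k + 4) (k # (k + 2) # tl xs) (k + 3))))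
             (Rel (k + 1) (k + 3))))))))
       (Neg (Rel (hd xs) z)))))"
| "graph (RMn f) = (\<lambda>k xs z. And
     (ExN k (And (Zero k) (graph f (k + 1) (z # xs) k)))
     (AllN k (Imp (Less k z) (ExN (k + 1) (And (Neg (Zero (k + 1)))
        (graph f (k + 2) (k # xs) (k + 1)))))))"

lemma sem_foldr_And: "sem E S (foldr And \<phi>s \<psi>) \<longleftrightarrow> (\<forall>\<phi>\<in>set \<phi>s. sem E S \<phi>) \<and> sem E S \<psi>"
  by (induction \<phi>s) auto

lemma sem_foldr_ExN:
  "sem E S (foldr ExN vs \<phi>) \<longleftrightarrow> (\<exists>E'. (\<forall>v. v \<notin> set vs \<longrightarrow> E' v = E v) \<and> sem E' S \<phi>)"
proof (induction vs arbitrary: E)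
  case Nil
  have "E' = E" if "\<forall>v. E' v = E v" for E' using that by auto
  then show ?case by auto
next
  case (Cons a vs)
  show ?case
  proof
    assume "sem E S (foldr ExN (a # vs) \<phi>)"
    then obtain n E' where "\<forall>v. v \<notin> set vs \<longrightarrow> E' v = (E(a := n)) v" "sem E' S \<phi>"
      by (auto simp: Cons.IH)
    then show "\<exists>E'. (\<forall>v. v \<notin> set (a # vs) \<longrightarrow> E' v = E v) \<and> sem E' S \<phi>"
      by (intro exI[of _ E']) auto
  next
    assume "\<exists>E'. (\<forall>v. v \<notin> set (a # vs) \<longrightarrow> E' v = E v) \<and> sem E' S \<phi>"
    then obtain E' where "\<forall>v. v \<notin> set (a # vs) \<longrightarrow> E' v = E v" "sem E' S \<phi>" by blast
    then show "sem E S (foldr ExN (a # vs) \<phi>)"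
      by (auto simp: Cons.IH intro!: exI[of _ "E' a"] exI[of _ E'])
  qed
qed

text \<open>The arguments lie below \<open>k\<close>, so binding variables from \<open>k\<close> on
  leaves their values alone. The claim holds for every \<open>S\<close> because \<open>graph\<close>
  rebinds the relation before using it; hence nested recursions can share one relation
  variable.\<close>

lemma sem_graph:
  "\<forall>x\<in>set xs. x < k \<Longrightarrow> z < k \<Longrightarrow> sem E S (graph f k xs z) \<longleftrightarrow> evalr f (map E xs) (E z)"
proof (induction f arbitrary: k xs z E S)
  case RZero
  then show ?case by (auto intro: ev_zero elim: evalr_zeroE)
next
  case RSucc
  then show ?case by (cases xs) (auto intro: ev_succ elim: evalr_succE)
next
  case (RProj i)
  then show ?case by (auto intro: evalr_projI elim: evalr_projE)
next
  case (RComp f gs)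
  define l where "l = k + length gs"
  define ys where "ys = [k..<l]"
  have len: "length ys = length gs" and ys: "\<forall>y\<in>set ys. y < l"
    using RComp.prems by (auto simp: ys_def l_def)
  have nth: "ys ! i = k + i" if "i < length gs" for i
    using that by (auto simp: ys_def l_def)
  have xs: "\<forall>x\<in>set xs. x < l" "z < l" using RComp.prems by (auto simp: l_def)
  have args: "map E' xs = map E xs" "E' z = E z" if "\<forall>v. v \<notin> set ys \<longrightarrow> E' v = E v" for E'
    using that RComp.prems by (auto simp: ys_def)
  have conj: "(\<forall>\<phi>\<in>set (map2 (\<lambda>G y. G l xs y) (map graph gs) ys). sem E' S \<phi>) \<longleftrightarrow>
      (\<forall>i<length gs. evalr (gs ! i) (map E' xs) (map E' ys ! i))" for E'
  proof -
    have "(\<forall>\<phi>\<in>set (map2 (\<lambda>G y. G l xs y) (map graph gs) ys). sem E' S \<phi>) \<longleftrightarrow>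
      (\<forall>i<length gs. sem E' S (graph (gs ! i) l xs (ys ! i)))"
      using len by (auto simp: all_set_conv_all_nth)
    also have "\<dots> \<longleftrightarrow> (\<forall>i<length gs. evalr (gs ! i) (map E' xs) (map E' ys ! i))"
      using RComp.IH(2) xs ys len by simp
    finally show ?thesis .
  qed
  have "sem E S (graph (RComp f gs) k xs z) \<longleftrightarrow>
      (\<exists>E'. (\<forall>v. v \<notin> set ys \<longrightarrow> E' v = E v) \<and>
        (\<forall>i<length gs. evalr (gs ! i) (map E' xs) (map E' ys ! i)) \<and> evalr f (map E' ys) (E' z))"
    by (simp only: graph.simps Let_def sem_foldr_ExN sem_foldr_And conj RComp.IH(1)[OF ys xs(2)]
        flip: l_def ys_def)
  also have "\<dots> \<longleftrightarrow>
      (\<exists>E'. (\<forall>v. v \<notin> set ys \<longrightarrow> E' v = E v) \<and>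
        (\<forall>i<length gs. evalr (gs ! i) (map E xs) (map E' ys ! i)) \<and> evalr f (map E' ys) (E z))"
    (is "_ \<longleftrightarrow> ?r")
    by (intro ex_cong1 conj_cong refl) (simp_all only: args)
  also have "\<dots> \<longleftrightarrow> evalr (RComp f gs) (map E xs) (E z)"
  proof
    assume ?r
    then show "evalr (RComp f gs) (map E xs) (E z)"
      unfolding evalr_comp_iff using len by (metis length_map)
  next
    assume "evalr (RComp f gs) (map E xs) (E z)"
    then obtain ns where ns: "length ns = length gs"
      "\<forall>i<length gs. evalr (gs ! i) (map E xs) (ns ! i)" "evalr f ns (E z)"
      unfolding evalr_comp_iff by blast
    define E' where "E' v = (if v \<in> set ys then ns ! (v - k) else E v)" for v
    have "map E' ys = ns"
      using len ns(1) nth by (intro nth_equalityI) (auto simp: E'_def in_set_conv_nth)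
    with ns show ?r by (intro exI[of _ E']) (auto simp: E'_def)
  qed
  finally show ?case .
next
  case (RPr f g)
  show ?case
  proof (cases xs)
    case Nil
    then show ?thesis by (auto elim: evalr_prE)
  next
    case (Cons x xs')
    with RPr.prems have xs': "\<forall>y\<in>set xs'. y < k" "\<forall>y\<in>set xs'. y < k + 4" and x: "x < k" "z < k"
      by auto
    have upd: "map (E(k := a, k + 1 := b, k + 2 := c, k + 3 := d)) xs' = map E xs'" for a b c d
      by (rule map_cong[OF refl]) (use xs'(1) in fastforce)
    have lt: "k + 2 < k + 4" "k + 3 < k + 4" and vs: "\<forall>y\<in>set (k # (k + 2) # xs'). y < k + 4"
      using xs'(2) by auto
    have f: "sem (E(k := a, k + 1 := b, k + 2 := c, k + 3 := d)) R (graph f (k + 4) xs' (k + 2)) \<longleftrightarrow>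
        evalr f (map E xs') c" for R a b c d
      by (simp only: RPr.IH(1)[OF xs'(2) lt(1)] upd) simp
    have g: "sem (E(k := a, k + 1 := b, k + 2 := c, k + 3 := d)) R
          (graph g (k + 4) (k # (k + 2) # xs') (k + 3)) \<longleftrightarrow>
        evalr g (a # c # map E xs') d" for R a b c d
      by (simp only: RPr.IH(2)[OF vs lt(2)] list.map upd) simp
    \<comment> \<open>\<open>a\<close>, \<open>b\<close>, \<open>c\<close>, \<open>d\<close> are m,
      its successor, v and w of \<open>evalr_pr_iff\<close>: atoms mention variables only, so the
      successor needs a variable of its own.\<close>
    have "sem E S (graph (RPr f g) k xs z) \<longleftrightarrow>
      (\<forall>R. (\<forall>a b c d. (a = 0 \<and> evalr f (map E xs') c \<longrightarrow> R a c) \<and>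
          (R a c \<and> b = Suc a \<and> evalr g (a # c # map E xs') d \<longrightarrow> R b d)) \<longrightarrow> R (E x) (E z))"
      by (simp only: Cons graph.simps sem.simps list.sel list.distinct if_False f g)
        (simp, intro iff_allI, fastforce)
    also have "\<dots> \<longleftrightarrow> evalr (RPr f g) (E x # map E xs') (E z)"
      unfolding evalr_pr_iff by (intro iff_allI arg_cong2[where f = "(\<longrightarrow>)"] refl) blast
    finally show ?thesis by (simp add: Cons)
  qed
next
  case (RMn f)
  have vs: "\<forall>y\<in>set (z # xs). y < k + 1" "\<forall>y\<in>set (k # xs). y < k + 2"
    and lt: "k < k + 1" "k + 1 < k + 2" and z: "z \<noteq> k"
    using RMn.prems by auto
  have upd: "map (E(k := a)) xs = map E xs" "map (E(k := a, k + 1 := b)) xs = map E xs" for a b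
    by (rule map_cong[OF refl]; use RMn.prems(1) in fastforce)+
  have f0: "sem (E(k := a)) S (graph f (k + 1) (z # xs) k) \<longleftrightarrow> evalr f (E z # map E xs) a" for a
    using z by (simp only: RMn.IH[OF vs(1) lt(1)] list.map upd) simp
  have f1: "sem (E(k := a, k + 1 := b)) S (graph f (k + 2) (k # xs) (k + 1)) \<longleftrightarrow>
      evalr f (a # map E xs) b" for a b
    by (simp only: RMn.IH[OF vs(2) lt(2)] list.map upd) simp
  have "(\<exists>n>0. P n) \<longleftrightarrow> (\<exists>n. P (Suc n))" for P
    using gr0_conv_Suc by auto
  then show ?case
    using z by (simp only: graph.simps sem.simps f0 f1) (simp add: evalr_mn_iff)
qed

section \<open>Second-order logic in the unfolding of a four-state structure\<close>

text \<open>The state \<open>[a + 2 * b]\<close> carries proposition 0 iff \<open>a = 1\<close> and proposition 1 iff \<open>b = 1\<close>, so a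
  path is a pair of sets of positive positions.\<close>

definition K4 :: cks where
  "K4 = \<lparr>ncomp = 1, locs = [[0, 1, 2, 3]], sts = [[0], [1], [2], [3]],
     trans = List.product [[0], [1], [2], [3]] [[0], [1], [2], [3]],
     lab = [([1], 0), ([3], 0), ([2], 1), ([3], 1)], init = [0]\<rparr>"

lemma wf_K4: "wf_cks K4"
  by (auto simp: wf_cks_def K4_def)

lemma trans_K4: "(s, t) \<in> set (trans K4) \<longleftrightarrow> s \<in> set (sts K4) \<and> t \<in> set (sts K4)"
  by (auto simp: K4_def)

lemma sts_K4: "set (sts K4) = {[0], [1], [2], [3]}"
  by (simp add: K4_def)

lemma tnode_sts: "tnode K4 u \<Longrightarrow> i < length u \<Longrightarrow> u ! i \<in> set (sts K4)"
  by (cases i) (auto simp: tnode_def trans_K4 hd_conv_nth K4_def)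

definition pfin :: "pform \<Rightarrow> pform" where
  "pfin \<psi> = PU (PNeg (PAnd \<psi> (PNeg \<psi>))) \<psi>"

definition pglob :: "pform \<Rightarrow> pform" where
  "pglob \<psi> = PNeg (pfin (PNeg \<psi>))"

definition pimp :: "pform \<Rightarrow> pform \<Rightarrow> pform" where
  "pimp \<psi> \<chi> = PNeg (PAnd \<psi> (PNeg \<chi>))"

definition piff :: "pform \<Rightarrow> pform \<Rightarrow> pform" where
  "piff \<psi> \<chi> = PAnd (pimp \<psi> \<chi>) (pimp \<chi> \<psi>)"

abbreviation atom :: "nat \<Rightarrow> pform" where
  "atom p \<equiv> PS (SProp p)"

lemma psat_derived [simp]:
  "psat K lb \<pi> (pfin \<psi>) \<longleftrightarrow> (\<exists>j. psat K lb (\<lambda>i. \<pi> (i + j)) \<psi>)"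
  "psat K lb \<pi> (pglob \<psi>) \<longleftrightarrow> (\<forall>j. psat K lb (\<lambda>i. \<pi> (i + j)) \<psi>)"
  "psat K lb \<pi> (pimp \<psi> \<chi>) \<longleftrightarrow> (psat K lb \<pi> \<psi> \<longrightarrow> psat K lb \<pi> \<chi>)"
  "psat K lb \<pi> (piff \<psi> \<chi>) \<longleftrightarrow> (psat K lb \<pi> \<psi> \<longleftrightarrow> psat K lb \<pi> \<chi>)"
  by (auto simp: pfin_def pglob_def pimp_def piff_def)

lemma psat_PX_pow [simp]: "psat K lb \<pi> ((PX ^^ n) \<psi>) \<longleftrightarrow> psat K lb (\<lambda>i. \<pi> (i + n)) \<psi>"
  by (induction n arbitrary: \<pi>) auto

lemma wf_derived [simp]:
  "wf_pform n (pfin \<psi>) = wf_pform n \<psi>"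
  "wf_pform n (pglob \<psi>) = wf_pform n \<psi>"
  "wf_pform n (pimp \<psi> \<chi>) = (wf_pform n \<psi> \<and> wf_pform n \<chi>)"
  "wf_pform n (piff \<psi> \<chi>) = (wf_pform n \<psi> \<and> wf_pform n \<chi>)"
  "wf_pform n ((PX ^^ m) \<psi>) = wf_pform n \<psi>"
  by (auto simp: pfin_def pglob_def pimp_def piff_def) (induction m; simp)+

text \<open>A positive number is a blind proposition true at that depth only, and zero is the blind
  proposition true nowhere, so that the unlabelled tree already interprets all variables.
  Proposition 2 carries the relation variable.\<close>

abbreviation nvar :: "nat \<Rightarrow> nat" where
  "nvar v \<equiv> v + 3"

text \<open>One path is enough: a blind proposition has the same value at all nodes of equal depth.
  Excluding the root leaves zero a single representation, the empty one.\<close>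

definition is_num :: "nat \<Rightarrow> sform" where
  "is_num p = SE (PAnd (PNeg (atom p)) (pglob (pimp (atom p) (PX (pglob (PNeg (atom p)))))))"

text \<open>Except for \<open>Rel\<close>, the path formula of an atom has the same value on all
  rooted paths; \<open>Rel\<close> selects the path that carries exactly the two marks. In
  \<open>Succ\<close> the first conjunct serves a zero \<open>v\<close>, which is marked
  nowhere.\<close>

primrec tr :: "so \<Rightarrow> sform" where
  "tr (Num v n) = SE ((PX ^^ n) (atom (nvar v)))"
| "tr (Zero v) = SE (pglob (PNeg (atom (nvar v))))"
| "tr (Succ v w) = SE (PAnd (pimp (pglob (PNeg (atom (nvar v)))) (PX (atom (nvar w))))
     (pglob (pimp (atom (nvar v)) (PX (atom (nvar w))))))"
| "tr (Eq v w) = SE (pglob (piff (atom (nvar v)) (atom (nvar w))))"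
| "tr (Less v w) = SE (PAnd (pfin (atom (nvar w)))
     (pglob (pimp (atom (nvar w)) (pglob (PNeg (atom (nvar v)))))))"
| "tr (Rel v w) = SE (PAnd
     (pglob (PAnd (piff (atom 0) (atom (nvar v))) (piff (atom 1) (atom (nvar w)))))
     (pfin (pglob (atom 2))))"
| "tr (Neg \<phi>) = SNeg (tr \<phi>)"
| "tr (And \<phi> \<psi>) = SAnd (tr \<phi>) (tr \<psi>)"
| "tr (ExN v \<phi>) = SEx [] (nvar v) (SAnd (is_num (nvar v)) (tr \<phi>))"
| "tr (ExR \<phi>) = SEx [0] 2 (tr \<phi>)"

lemma wf_tr: "wf_sform 1 (tr \<phi>)"
  by (induction \<phi>) (auto simp: is_num_def)

section \<open>Numbers as marked depths\<close>

definition mark :: "nat \<Rightarrow> nat \<Rightarrow> bool" where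
  "mark n i \<longleftrightarrow> 0 < i \<and> i = n"

lemma mark_eq: "(\<forall>i. mark m i \<longleftrightarrow> mark n i) \<longleftrightarrow> m = n"
  unfolding mark_def by (metis gr0I)

lemma mark_succ:
  "((\<forall>i. \<not> mark m i) \<longrightarrow> mark n (Suc 0)) \<and> (\<forall>i. mark m i \<longrightarrow> mark n (Suc i)) \<longleftrightarrow> n = Suc m"
  by (cases m) (auto simp: mark_def)

text \<open>An unmarked \<open>m\<close> is zero and passes the second conjunct; the first one
  excludes an unmarked \<open>n\<close>, since nothing is below zero.\<close>

lemma mark_less:
  "(\<exists>j. mark n j) \<and> (\<forall>j. mark n j \<longrightarrow> (\<forall>i. \<not> mark m (i + j))) \<longleftrightarrow> m < n"
proof -
  have "(\<forall>i. m \<noteq> i + n) \<longleftrightarrow> m < n"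
    by (metis le_add2 le_add_diff_inverse2 not_less)
  then show ?thesis by (cases "n = 0") (auto simp: mark_def)
qed

section \<open>Paths that encode pairs of numbers\<close>

definition pstate :: "nat \<Rightarrow> nat \<Rightarrow> nat \<Rightarrow> nat list" where
  "pstate x y i = [(if mark x i then 1 else 0) + (if mark y i then 2 else 0)]"

definition ppath :: "nat \<Rightarrow> nat \<Rightarrow> nat \<Rightarrow> nat list list" where
  "ppath x y i = map (pstate x y) [0..<Suc i]"

definition rooted :: "(nat \<Rightarrow> nat list list) \<Rightarrow> bool" where
  "rooted \<pi> \<longleftrightarrow> tpath K4 \<pi> \<and> \<pi> 0 = [init K4]"

lemma rooted_length: "rooted \<pi> \<Longrightarrow> length (\<pi> i) = Suc i"
proof (induction i)
  case (Suc i)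
  then obtain s where "\<pi> (Suc i) = \<pi> i @ [s]" by (auto simp: rooted_def tpath_def)
  with Suc show ?case by simp
qed (simp add: rooted_def)

lemma rooted_tnode: "rooted \<pi> \<Longrightarrow> tnode K4 (\<pi> i)"
  by (simp add: rooted_def tpath_def)

lemma ppath_Suc: "ppath x y (Suc i) = ppath x y i @ [pstate x y (Suc i)]"
  by (simp add: ppath_def)

lemma last_ppath: "last (ppath x y i) = pstate x y i"
  by (simp add: ppath_def)

lemma length_ppath [simp]: "length (ppath x y i) = Suc i"
  by (simp add: ppath_def)

text \<open>Depth 0 is never marked, which lets every pair be written on a path from the
  root.\<close>

lemma pstate_0: "pstate x y 0 = init K4"
  by (simp add: pstate_def mark_def K4_def)

lemma pstate_sts: "pstate x y i \<in> set (sts K4)"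
  by (simp add: pstate_def K4_def)

lemma rooted_ppath: "rooted (ppath x y)"
proof -
  have "ppath x y i ! j = pstate x y j" if "j \<le> i" for i j
    using that by (simp add: ppath_def nth_append del: upt_Suc)
  moreover have "hd (ppath x y i) = init K4" for i
    by (simp add: ppath_def pstate_0 hd_map del: upt_Suc)
  moreover have "ppath x y i \<noteq> []" for i by (simp add: ppath_def)
  ultimately have "tnode K4 (ppath x y i)" for i
    by (simp add: tnode_def trans_K4 pstate_sts)
  then show ?thesis
    by (auto simp: rooted_def tpath_def ppath_Suc last_ppath trans_K4 pstate_sts)
       (simp add: ppath_def pstate_0)
qed

text \<open>The two bits determine a state of \<open>K4\<close> and the states determine the path,
  so a formula that fixes both bits along a path leaves one candidate.\<close>

lemma rooted_eq_ppath:
  assumes "rooted \<pi>"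
    and "\<And>i. last (\<pi> i) \<in> {[1], [3]} \<longleftrightarrow> mark x i" "\<And>i. last (\<pi> i) \<in> {[2], [3]} \<longleftrightarrow> mark y i"
  shows "\<pi> = ppath x y"
proof
  fix i show "\<pi> i = ppath x y i"
  proof (induction i)
    case 0
    then show ?case using assms(1) by (simp add: rooted_def ppath_def pstate_0)
  next
    case (Suc i)
    obtain s where s: "\<pi> (Suc i) = \<pi> i @ [s]" "s \<in> set (sts K4)"
      using assms(1) by (auto simp: rooted_def tpath_def trans_K4)
    then have "s = pstate x y (Suc i)"
      using assms(2,3)[of "Suc i"] by (auto simp: pstate_def sts_K4)
    with s Suc show ?case by (simp add: ppath_Suc)
  qed
qed

lemma pstate_bits:
  "pstate x y i \<in> {[1], [3]} \<longleftrightarrow> mark x i" "pstate x y i \<in> {[2], [3]} \<longleftrightarrow> mark y i"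
  by (auto simp: pstate_def)

text \<open>The bounds put both marks inside the prefix, so an absent mark really means
  zero.\<close>

lemma ppath_inj:
  assumes "ppath x y m = ppath x' y' m" "x \<le> m" "y \<le> m" "x' \<le> m" "y' \<le> m"
  shows "x = x' \<and> y = y'"
proof -
  have "pstate x y i = pstate x' y' i" if "i \<le> m" for i
    using assms(1) that by (auto simp: ppath_def simp del: upt_Suc)
  then have *: "mark x i = mark x' i" "mark y i = mark y' i" if "i \<le> m" for i
    using that pstate_bits by metis+
  show ?thesis
    using *[of x] *[of y] *[of x'] *[of y'] assms(2-) by (auto simp: mark_def)
qed

text \<open>The invariant of the translation. A relation is read off the tails of the encoding
  paths, so every labelling of proposition 2 stands for some relation.\<close>

definition reps :: "(nat list list \<Rightarrow> nat set) \<Rightarrow> (nat \<Rightarrow> nat) \<Rightarrow> (nat \<Rightarrow> nat \<Rightarrow> bool) \<Rightarrow> bool" where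
  "reps lb E S \<longleftrightarrow>
     (\<forall>u. tnode K4 u \<longrightarrow>
        (0 \<in> lb u \<longleftrightarrow> last u \<in> {[1], [3]}) \<and> (1 \<in> lb u \<longleftrightarrow> last u \<in> {[2], [3]}) \<and>
        (\<forall>v. nvar v \<in> lb u \<longleftrightarrow> mark (E v) (length u - 1))) \<and>
     (\<forall>x y. S x y \<longleftrightarrow> (\<exists>N. \<forall>m. 2 \<in> lb (ppath x y (m + N))))"

lemma reps_rooted:
  assumes "reps lb E S" "rooted \<pi>"
  shows "0 \<in> lb (\<pi> i) \<longleftrightarrow> last (\<pi> i) \<in> {[1], [3]}" "Suc 0 \<in> lb (\<pi> i) \<longleftrightarrow> last (\<pi> i) \<in> {[2], [3]}"
    "nvar v \<in> lb (\<pi> i) \<longleftrightarrow> mark (E v) i"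
  using assms rooted_tnode[OF assms(2)] rooted_length[OF assms(2)] by (auto simp: reps_def)

section \<open>Correctness of the translation\<close>

lemma ssat_SE_root: "ssat K4 lb [init K4] (SE \<psi>) \<longleftrightarrow> (\<exists>\<pi>. rooted \<pi> \<and> psat K4 lb \<pi> \<psi>)"
  by (auto simp: rooted_def)

lemma ssat_SE_const:
  assumes "\<And>\<pi>. rooted \<pi> \<Longrightarrow> psat K4 lb \<pi> \<psi> \<longleftrightarrow> P"
  shows "ssat K4 lb [init K4] (SE \<psi>) \<longleftrightarrow> P"
  unfolding ssat_SE_root using assms rooted_ppath by blast

lemma is_num_sem:
  assumes "uniform K4 [] p lb"
  shows "ssat K4 lb [init K4] (is_num p) \<longleftrightarrow>
    (\<exists>n. \<forall>u. tnode K4 u \<longrightarrow> (p \<in> lb u \<longleftrightarrow> mark n (length u - 1)))"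
proof -
  \<comment> \<open>With the empty observation, nodes of equal depth are indistinguishable. The root
    has length 1, hence the offset.\<close>
  have lev: "p \<in> lb u \<longleftrightarrow> p \<in> lb (\<pi> (length u - 1))" if "tnode K4 u" "rooted \<pi>" for u \<pi>
    using assms that rooted_tnode[OF that(2)]
    by (auto simp: uniform_def obs_eq_def rooted_length tnode_def)
  have "psat K4 lb \<pi> (PAnd (PNeg (atom p)) (pglob (pimp (atom p) (PX (pglob (PNeg (atom p))))))) \<longleftrightarrow>
    (\<exists>n. \<forall>u. tnode K4 u \<longrightarrow> (p \<in> lb u \<longleftrightarrow> mark n (length u - 1)))" (is "?l \<longleftrightarrow> ?r")
    if \<pi>: "rooted \<pi>" for \<pi>
  proof
    assume ?l
    then have 0: "p \<notin> lb (\<pi> 0)" and later: "p \<in> lb (\<pi> j) \<Longrightarrow> p \<notin> lb (\<pi> (Suc (i + j)))" for i j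
      by (auto simp: add_ac)
    have "\<exists>n. \<forall>i. p \<in> lb (\<pi> i) \<longleftrightarrow> mark n i"
    proof (cases "\<exists>n. p \<in> lb (\<pi> n)")
      case True
      then obtain n where n: "p \<in> lb (\<pi> n)" by blast
      \<comment> \<open>For \<open>n < i\<close> the shift \<open>i - Suc n\<close> makes
        \<open>Suc (i - Suc n + n)\<close> equal to \<open>i\<close>; the other order is
        symmetric.\<close>
      have "i = n" if "p \<in> lb (\<pi> i)" for i
        using later[OF n, of "i - Suc n"] later[OF that, of "n - Suc i"] n that
        by (cases i n rule: linorder_cases) auto
      then show ?thesis using n 0 by (metis mark_def gr0I)
    next
      case False
      then show ?thesis by (intro exI[of _ 0]) (auto simp: mark_def)
    qed
    then show ?r using lev[OF _ \<pi>] by blast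
  next
    assume ?r
    then obtain n where n: "p \<in> lb (\<pi> i) \<longleftrightarrow> mark n i" for i
      using rooted_tnode[OF \<pi>] rooted_length[OF \<pi>] by fastforce
    then show ?l by (auto simp: mark_def)
  qed
  then show ?thesis unfolding is_num_def by (rule ssat_SE_const)
qed

text \<open>The only component is the whole state, so observing it tells all nodes of the tree apart
  and the constraint is void.\<close>

lemma uniform_full: "uniform K4 [0] p lb"
proof -
  have "u = v" if "tnode K4 u" "tnode K4 v" "obs_eq [0] u v" for u v
  proof (rule nth_equalityI)
    show "length u = length v" using that(3) by (simp add: obs_eq_def)
    fix k assume k: "k < length u"
    then have "u ! k ! 0 = v ! k ! 0" "u ! k \<in> set (sts K4)" "v ! k \<in> set (sts K4)"
      using that tnode_sts by (auto simp: obs_eq_def)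
    then show "u ! k = v ! k" by (auto simp: sts_K4)
  qed
  then show ?thesis by (auto simp: uniform_def)
qed

lemma ex_reps_num:
  assumes "reps lb E S"
  obtains lb' where "\<forall>u q. q \<noteq> nvar v \<longrightarrow> (q \<in> lb' u \<longleftrightarrow> q \<in> lb u)" "uniform K4 [] (nvar v) lb'"
    "reps lb' (E(v := n)) S"
proof
  define lb' where "lb' u = (if mark n (length u - 1) then insert (nvar v) (lb u)
    else lb u - {nvar v})" for u
  show eq: "\<forall>u q. q \<noteq> nvar v \<longrightarrow> (q \<in> lb' u \<longleftrightarrow> q \<in> lb u)" by (simp add: lb'_def)
  have v: "nvar v \<in> lb' u \<longleftrightarrow> mark n (length u - 1)" for u by (simp add: lb'_def)
  then show "uniform K4 [] (nvar v) lb'" by (simp add: uniform_def obs_eq_def)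
  show "reps lb' (E(v := n)) S" using assms eq v by (auto simp: reps_def)
qed

text \<open>Proposition 2 is placed on all sufficiently long prefixes: a single prefix would not tell an
  unmarked position (zero) from one marked later.\<close>

lemma ex_reps_rel:
  assumes "reps lb E S"
  obtains lb' where "\<forall>u q. q \<noteq> 2 \<longrightarrow> (q \<in> lb' u \<longleftrightarrow> q \<in> lb u)" "reps lb' E S'"
proof
  define P where "P u \<longleftrightarrow> (\<exists>x y m. S' x y \<and> x \<le> m \<and> y \<le> m \<and> u = ppath x y m)" for u
  define lb' where "lb' u = (if P u then insert 2 (lb u) else lb u - {2})" for u
  show eq: "\<forall>u q. q \<noteq> 2 \<longrightarrow> (q \<in> lb' u \<longleftrightarrow> q \<in> lb u)" by (simp add: lb'_def)
  have "S' x y \<longleftrightarrow> (\<exists>N. \<forall>m. P (ppath x y (m + N)))" for x y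
  proof
    assume "S' x y"
    then show "\<exists>N. \<forall>m. P (ppath x y (m + N))"
      unfolding P_def using trans_le_add2 le_add1 le_add2 by metis
  next
    assume "\<exists>N. \<forall>m. P (ppath x y (m + N))"
    \<comment> \<open>At this depth the prefix contains both marks, as \<open>ppath_inj\<close>
      requires.\<close>
    then obtain N where "P (ppath x y (x + y + N))" by blast
    then obtain x' y' m where *: "S' x' y'" "x' \<le> m" "y' \<le> m"
      "ppath x y (x + y + N) = ppath x' y' m" by (auto simp: P_def)
    then have "m = x + y + N" by (metis length_ppath nat.inject)
    with * ppath_inj[of x y m x' y'] show "S' x y" by simp
  qed
  moreover have "2 \<in> lb' u \<longleftrightarrow> P u" for u by (simp add: lb'_def)
  moreover have "nvar v \<in> lb' u \<longleftrightarrow> nvar v \<in> lb u" "0 \<in> lb' u \<longleftrightarrow> 0 \<in> lb u"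
    "1 \<in> lb' u \<longleftrightarrow> 1 \<in> lb u" for u v using eq by auto
  ultimately show "reps lb' E S'" using assms by (simp add: reps_def)
qed

lemma ssat_tr: "reps lb E S \<Longrightarrow> ssat K4 lb [init K4] (tr \<phi>) \<longleftrightarrow> sem E S \<phi>"
proof (induction \<phi> arbitrary: lb E S)
  case (Num v n)
  then show ?case unfolding tr.simps
    by (intro ssat_SE_const) (auto simp: reps_rooted mark_def)
next
  case (Zero v)
  then show ?case unfolding tr.simps
    by (intro ssat_SE_const) (auto simp: reps_rooted mark_def)
next
  case (Succ v w)
  then show ?case unfolding tr.simps
    by (intro ssat_SE_const) (simp add: reps_rooted mark_succ)
next
  case (Eq v w)
  then show ?case unfolding tr.simps
    by (intro ssat_SE_const) (simp add: reps_rooted mark_eq)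
next
  case (Less v w)
  then show ?case unfolding tr.simps
    by (intro ssat_SE_const) (simp add: reps_rooted mark_less)
next
  case (Rel v w)
  let ?\<psi> = "PAnd (pglob (PAnd (piff (atom 0) (atom (nvar v))) (piff (atom 1) (atom (nvar w)))))
     (pfin (pglob (atom 2)))"
  have "psat K4 lb \<pi> ?\<psi> \<longleftrightarrow>
      \<pi> = ppath (E v) (E w) \<and> (\<exists>N. \<forall>m. 2 \<in> lb (\<pi> (m + N)))" if "rooted \<pi>" for \<pi>
  proof -
    have "psat K4 lb \<pi> ?\<psi> \<longleftrightarrow> (\<forall>i. (last (\<pi> i) \<in> {[1], [3]} \<longleftrightarrow> mark (E v) i) \<and>
        (last (\<pi> i) \<in> {[2], [3]} \<longleftrightarrow> mark (E w) i)) \<and> (\<exists>N. \<forall>m. 2 \<in> lb (\<pi> (m + N)))"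
      using reps_rooted[OF Rel that] by simp
    also have "(\<forall>i. (last (\<pi> i) \<in> {[1], [3]} \<longleftrightarrow> mark (E v) i) \<and>
        (last (\<pi> i) \<in> {[2], [3]} \<longleftrightarrow> mark (E w) i)) \<longleftrightarrow> \<pi> = ppath (E v) (E w)"
      using rooted_eq_ppath[OF that] pstate_bits last_ppath by metis
    finally show ?thesis .
  qed
  then have "ssat K4 lb [init K4] (tr (Rel v w)) \<longleftrightarrow>
      (\<exists>N. \<forall>m. 2 \<in> lb (ppath (E v) (E w) (m + N)))"
    unfolding tr.simps ssat_SE_root using rooted_ppath by metis
  then show ?case using Rel by (simp add: reps_def)
next
  case (ExN v \<phi>)
  show ?case
  proof
    assume "ssat K4 lb [init K4] (tr (ExN v \<phi>))"
    then obtain lb' where eq: "\<forall>u q. q \<noteq> nvar v \<longrightarrow> (q \<in> lb' u \<longleftrightarrow> q \<in> lb u)"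
      and uni: "uniform K4 [] (nvar v) lb'" and num: "ssat K4 lb' [init K4] (is_num (nvar v))"
      and \<phi>: "ssat K4 lb' [init K4] (tr \<phi>)"
      by auto
    from num obtain n where "\<forall>u. tnode K4 u \<longrightarrow> (nvar v \<in> lb' u \<longleftrightarrow> mark n (length u - 1))"
      unfolding is_num_sem[OF uni] by blast
    with eq ExN.prems have "reps lb' (E(v := n)) S" by (auto simp: reps_def)
    with ExN.IH \<phi> have "sem (E(v := n)) S \<phi>" by blast
    then show "sem E S (ExN v \<phi>)" unfolding sem.simps by blast
  next
    assume "sem E S (ExN v \<phi>)"
    then obtain n where n: "sem (E(v := n)) S \<phi>" by auto
    obtain lb' where lb': "\<forall>u q. q \<noteq> nvar v \<longrightarrow> (q \<in> lb' u \<longleftrightarrow> q \<in> lb u)"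
      "uniform K4 [] (nvar v) lb'" "reps lb' (E(v := n)) S"
      using ex_reps_num[OF ExN.prems] .
    have "\<forall>u. tnode K4 u \<longrightarrow> (nvar v \<in> lb' u \<longleftrightarrow> mark n (length u - 1))"
      using lb'(3) by (simp add: reps_def)
    then have "ssat K4 lb' [init K4] (is_num (nvar v))"
      unfolding is_num_sem[OF lb'(2)] by blast
    moreover have "ssat K4 lb' [init K4] (tr \<phi>)" using ExN.IH[OF lb'(3)] n by blast
    ultimately show "ssat K4 lb [init K4] (tr (ExN v \<phi>))"
      using lb'(1,2) unfolding tr.simps ssat.simps by blast
  qed
next
  case (ExR \<phi>)
  show ?case
  proof
    assume "ssat K4 lb [init K4] (tr (ExR \<phi>))"
    then obtain lb' where eq: "\<forall>u q. q \<noteq> 2 \<longrightarrow> (q \<in> lb' u \<longleftrightarrow> q \<in> lb u)"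
      and \<phi>: "ssat K4 lb' [init K4] (tr \<phi>)"
      by auto
    have "nvar v \<in> lb' u \<longleftrightarrow> nvar v \<in> lb u" "0 \<in> lb' u \<longleftrightarrow> 0 \<in> lb u"
      "1 \<in> lb' u \<longleftrightarrow> 1 \<in> lb u" for u v using eq by auto
    \<comment> \<open>Whatever the new labelling of 2 is, its tails define the relation that serves
      as witness.\<close>
    then have "reps lb' E (\<lambda>x y. \<exists>N. \<forall>m. 2 \<in> lb' (ppath x y (m + N)))"
      using ExR.prems by (simp add: reps_def)
    with ExR.IH \<phi> show "sem E S (ExR \<phi>)" by auto
  next
    assume "sem E S (ExR \<phi>)"
    then obtain S' where S': "sem E S' \<phi>" by auto
    obtain lb' where "\<forall>u q. q \<noteq> 2 \<longrightarrow> (q \<in> lb' u \<longleftrightarrow> q \<in> lb u)" "reps lb' E S'"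
      using ex_reps_rel[OF ExR.prems] .
    with S' ExR.IH uniform_full show "ssat K4 lb [init K4] (tr (ExR \<phi>))" by auto
  qed
qed auto

lemma reps_lab0: "reps (lab0 K4) (\<lambda>_. 0) (\<lambda>_ _. False)"
  by (auto simp: reps_def lab0_def K4_def mark_def)

lemma mc_tr: "mc K4 (tr \<phi>) \<longleftrightarrow> sem (\<lambda>_. 0) (\<lambda>_ _. False) \<phi>"
  using wf_K4 wf_tr[of \<phi>] ssat_tr[OF reps_lab0, of \<phi>] by (simp add: mc_def K4_def)

section \<open>Diagonalisation\<close>

lemma enc_form_inj: "enc_s \<phi> = enc_s \<phi>' \<Longrightarrow> \<phi> = \<phi>'" "enc_p \<psi> = enc_p \<psi>' \<Longrightarrow> \<psi> = \<psi>'"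
proof (induction \<phi> and \<psi> arbitrary: \<phi>' and \<psi>')
  case (SProp p) then show ?case by (cases \<phi>') (auto simp: list_encode_eq simp del: list_encode.simps)
next
  case (SNeg \<phi>) then show ?case by (cases \<phi>') (auto simp: list_encode_eq simp del: list_encode.simps)
next
  case (SAnd \<phi> \<psi>) then show ?case by (cases \<phi>') (auto simp: list_encode_eq simp del: list_encode.simps)
next
  case (SE \<psi>) then show ?case by (cases \<phi>') (auto simp: list_encode_eq simp del: list_encode.simps)
next
  case (SEx ob p \<phi>) then show ?case by (cases \<phi>') (auto simp: list_encode_eq simp del: list_encode.simps)
next
  case (PS \<phi>) then show ?case by (cases \<psi>') (auto simp: list_encode_eq simp del: list_encode.simps)
next
  case (PNeg \<psi>) then show ?case by (cases \<psi>') (auto simp: list_encode_eq simp del: list_encode.simps)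
next
  case (PAnd \<psi> \<chi>) then show ?case by (cases \<psi>') (auto simp: list_encode_eq simp del: list_encode.simps)
next
  case (PX \<psi>) then show ?case by (cases \<psi>') (auto simp: list_encode_eq simp del: list_encode.simps)
next
  case (PU \<psi> \<chi>) then show ?case by (cases \<psi>') (auto simp: list_encode_eq simp del: list_encode.simps)
qed

lemma enc_nll_inj: "enc_nll xs = enc_nll ys \<Longrightarrow> xs = ys"
  using inj_list_encode[of UNIV] by (auto simp: enc_nll_def list_encode_eq)

lemma enc_cks_inj:
  assumes "enc_cks K = enc_cks K'"
  shows "K = K'"
proof -
  have "inj (\<lambda>(s, t). prod_encode (list_encode s, list_encode t))"
    "inj (\<lambda>(s, p). prod_encode (list_encode s, p))"
    by (auto simp: inj_def list_encode_eq)
  with assms show ?thesis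
    by (intro cks.equality)
       (auto simp: enc_cks_def list_encode_eq dest: enc_nll_inj)
qed

text \<open>Injectivity of the encodings excludes that a different structure or formula with the
  same code puts it into the set.\<close>

lemma MC_set_iff: "prod_encode (enc_cks K, enc_s \<phi>) \<in> MC_set \<longleftrightarrow> mc K \<phi>"
  by (auto simp: MC_set_def dest: enc_cks_inj enc_form_inj)

text \<open>Substituting \<open>n\<close> for the variable 0 in \<open>\<phi>\<close> is replaced by quantifying over a variable
  that equals \<open>n\<close>, so the code of the result is a simple arithmetical function of \<open>n\<close> and
  the code of \<open>\<phi>\<close>, and no decoding is needed.\<close>

definition inst :: "so \<Rightarrow> nat \<Rightarrow> so" where
  "inst \<phi> n = ExN 0 (And (Num 0 n) \<phi>)"

text \<open>The 3 is \<open>nvar 0\<close> and the 8 is the tag of \<open>PX\<close>; each step of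
  the recursion prefixes one \<open>PX\<close>.\<close>

definition rnum :: recf where
  "rnum = RPr (rconst (enc_p (atom 3))) (rlist [rconst 8, RProj 1])"

lemma evalr_rnum: "evalr rnum [n] (enc_p ((PX ^^ n) (atom 3)))"
proof (induction n)
  case 0
  show ?case unfolding rnum_def by (simp only: funpow.simps id_apply) (rule ev_pr0, rule evalr_rconst)
next
  case (Suc n)
  have "evalr (rlist [rconst 8, RProj 1]) [n, y] (list_encode [8, y])" for y
    by (intro evalr_rlist) (auto intro: evalr_rconst evalr_projI)
  with Suc show ?case unfolding rnum_def by (simp del: list_encode.simps) (rule ev_prS)
qed

text \<open>Follows the layout of \<open>tr (inst \<phi> n)\<close> with the tags 4, 2 and 3 of
  \<open>SEx\<close>, \<open>SAnd\<close> and \<open>SE\<close>; the first \<open>rconst 3\<close>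
  is the proposition \<open>nvar 0\<close>. The input serves twice, as the number for
  \<open>rnum\<close> and as the code of \<open>\<phi>\<close> for \<open>RProj 0\<close>.\<close>

definition rdiag :: recf where
  "rdiag = RComp rpair [rconst (enc_cks K4),
     rlist [rconst 4, rconst (list_encode []), rconst 3,
       rlist [rconst 2, rconst (enc_s (is_num 3)),
         rlist [rconst 2, rlist [rconst 3, rnum], RProj 0]]]]"

lemma evalr_rdiag:
  assumes "n = enc_s (tr \<phi>)"
  shows "evalr rdiag [n] (prod_encode (enc_cks K4, enc_s (tr (inst \<phi> n))))"
proof -
  have "evalr (RProj 0) [n] (enc_s (tr \<phi>))" using assms by (intro evalr_projI) auto
  then show ?thesis
    unfolding rdiag_def inst_def
    by (auto simp del: list_encode.simps rlist.simps rconst.simps funpow.simps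
        intro!: evalr_comp2[OF _ _ evalr_rpair] evalr_rlist evalr_rconst evalr_rnum)
qed

theorem theorem3:
  shows "\<not> decidable_set MC_set"
proof
  assume "decidable_set MC_set"
  then obtain f where f: "evalr f [x] (if x \<in> MC_set then 1 else 0)" for x
    unfolding decidable_set_def by blast
  \<comment> \<open>With variable 0 holding a code, this says that \<open>f\<close> answers 0 on the
    output of \<open>rdiag\<close>, so that it rejects the diagonal sentence. Variable 1 holds the
    answer, so fresh variables start at 2.\<close>
  define \<phi> where "\<phi> = ExN 1 (And (Zero 1) (graph (RComp f [rdiag]) 2 [0] 1))"
  define n where "n = enc_s (tr \<phi>)"
  define c where "c = prod_encode (enc_cks K4, enc_s (tr (inst \<phi> n)))"
  have "c \<in> MC_set \<longleftrightarrow> mc K4 (tr (inst \<phi> n))"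
    unfolding c_def by (rule MC_set_iff)
  also have "\<dots> \<longleftrightarrow> evalr (RComp f [rdiag]) [n] 0"
  proof -
    \<comment> \<open>The code of a formula is positive, so \<open>Num 0 n\<close> does name
      \<open>n\<close>.\<close>
    have "0 < n" by (simp add: n_def \<phi>_def)
    then show ?thesis
      by (simp add: mc_tr inst_def \<phi>_def sem_graph del: graph.simps tr.simps)
  qed
  also have "\<dots> \<longleftrightarrow> c \<notin> MC_set"
  proof -
    have *: "evalr (RComp f [rdiag]) [n] (if c \<in> MC_set then 1 else 0)"
      using evalr_comp1[OF evalr_rdiag[OF n_def]] f c_def by blast
    \<comment> \<open>By \<open>evalr_det\<close>, the answer 0 is possible only if the value in
      \<open>*\<close> is 0.\<close>
    show ?thesis using * evalr_det[OF *, of 0] by (auto split: if_splits)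
  qed
  finally show False by blast
qed

end
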